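(* Let $k$ be a non-archimedean local field, let $G$ be a closed subgroup of $\operatorname{GL}_2(k)$ that contains $\operatorname{SL}_2(k)$, and let $\pi$ be a smooth (complex) representation of $G$. Let $\ell,\ell'$ be segments. Suppose that $\ell\subseteq\ell'$ or $\ell\supseteq\ell'$ or $\#(\ell\cap\ell')\geq 2$. Then $$e_\ell\circ e_{\ell'} = e_{\ell\cap\ell'}.$$
   Context: Let $\mathfrak{o}$ be the ring of integers of $k$ and $\mathfrak{p}$ its maximal ideal. $G$ is equipped with a Haar measure $dg$. A segment is a nonempty finite set of consecutive integers $m..n := \{m, m+1, \dots, n\}$, with integers $m\le n$; $\#$ denotes cardinality. For a segment $\ell = m..n$ let $R_\ell := \begin{bmatrix}\mathfrak{o} & \mathfrak{p}^{-m}\\ \mathfrak{p}^{n} & \mathfrak{o}\end{bmatrix}$ be the corresponding order in $M_2(k)$ (matrices with entries in the indicated sets), $R_\ell^\times$ its unit group, and $K_\ell := R_\ell^\times\cap G$. For $f\in C_c^\infty(G)$, $\pi(f)v := \int_G f(g)\pi(g)v\,dg$. For a segment $\ell$, $e_\ell := \pi(\operatorname{vol}(K_\ell)^{-1}1_{K_\ell})\in\operatorname{End}(\pi)$ is the averaging operator over $K_\ell$, an idempotent whose image is the space of $K_\ell$-fixed vectors. *)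

theory Defs
  imports "HOL-Analysis.Analysis"
begin

text \<open>
  A non-archimedean local field: a field whose topology is locally compact and is induced by a
  nontrivial non-archimedean absolute value.
\<close>

class nonarch_local_field = field + metric_space +
  fixes abs_val :: "'a \<Rightarrow> real"
  assumes dist_abs_val: "dist x y = abs_val (x - y)"
    and abs_val_mult: "abs_val (x * y) = abs_val x * abs_val y"
    and abs_val_ultrametric: "abs_val (x + y) \<le> max (abs_val x) (abs_val y)"
    and abs_val_nontrivial: "\<exists>x. x \<noteq> 0 \<and> abs_val x \<noteq> 1"
    and locally_compact: "\<exists>U C. open U \<and> x \<in> U \<and> U \<subseteq> C \<and> compact C"

definition ring_of_integers :: "'k::nonarch_local_field set" where
  "ring_of_integers = {x. abs_val x \<le> 1}"

definition max_ideal :: "'k::nonarch_local_field set" where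
  "max_ideal = {x. abs_val x < 1}"

text \<open>
  The fractional ideal \<open>\<pp>\<^sup>i\<close>, \<open>i\<close> an integer: generated by \<open>u\<^sup>i\<close> for a generator \<open>u\<close> of the
  maximal ideal. Generators differ by units, so all of them give the same set.
\<close>

definition max_ideal_pow :: "int \<Rightarrow> 'k::nonarch_local_field set" where
  "max_ideal_pow i =
    {u powi i * x | u x. max_ideal = (*) u ` ring_of_integers \<and> x \<in> ring_of_integers}"

definition SL2 :: "('k::field^2^2) set" where
  "SL2 = {A. det A = 1}"

definition GL2 :: "('k::field^2^2) set" where
  "GL2 = {A. invertible A}"

definition closed_subgroup_GL2 :: "('k::nonarch_local_field^2^2) set \<Rightarrow> bool" where
  "closed_subgroup_GL2 G \<longleftrightarrow>
    G \<subseteq> GL2 \<and> mat 1 \<in> G \<and> (\<forall>A\<in>G. \<forall>B\<in>G. A ** B \<in> G) \<and> (\<forall>A\<in>G. matrix_inv A \<in> G) \<and>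
    closedin (top_of_set GL2) G"

text \<open>Left Haar measure: a nonzero left-invariant Radon measure on the Borel sets of \<open>G\<close>.\<close>

definition haar_measure :: "('k::nonarch_local_field^2^2) set \<Rightarrow> ('k^2^2) measure \<Rightarrow> bool" where
  "haar_measure G \<mu> \<longleftrightarrow>
    sets \<mu> = sets (restrict_space borel G) \<and>
    emeasure \<mu> G \<noteq> 0 \<and>
    (\<forall>C. compact C \<and> C \<subseteq> G \<longrightarrow> emeasure \<mu> C < \<infinity>) \<and>
    (\<forall>A\<in>sets \<mu>. emeasure \<mu> A = (INF U\<in>{U. openin (top_of_set G) U \<and> A \<subseteq> U}. emeasure \<mu> U)) \<and>
    (\<forall>U. openin (top_of_set G) U \<longrightarrow>
      emeasure \<mu> U = (SUP C\<in>{C. compact C \<and> C \<subseteq> U}. emeasure \<mu> C)) \<and>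
    (\<forall>g\<in>G. \<forall>A\<in>sets \<mu>. emeasure \<mu> ((**) g ` A) = emeasure \<mu> A)"

text \<open>The complex vector space is all of \<open>'v\<close>, with scalar multiplication \<open>smul\<close>.\<close>

definition smooth_representation ::
    "('k::nonarch_local_field^2^2) set \<Rightarrow> (complex \<Rightarrow> 'v::ab_group_add \<Rightarrow> 'v) \<Rightarrow>
      ('k^2^2 \<Rightarrow> 'v \<Rightarrow> 'v) \<Rightarrow> bool" where
  "smooth_representation G smul \<pi> \<longleftrightarrow>
    vector_space smul \<and>
    (\<forall>g\<in>G. Vector_Spaces.linear smul smul (\<pi> g)) \<and>
    \<pi> (mat 1) = id \<and>
    (\<forall>g\<in>G. \<forall>h\<in>G. \<pi> (g ** h) = \<pi> g \<circ> \<pi> h) \<and>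
    (\<forall>v. openin (top_of_set G) {g \<in> G. \<pi> g v = v})"

text \<open>
  The integral of a locally constant, compactly supported function \<open>F\<close> with values in a complex
  vector space without topology. Such an \<open>F\<close> takes finitely many values, and every nonzero value
  is taken on a set of finite measure.
\<close>

definition vec_integral ::
    "(complex \<Rightarrow> 'v::ab_group_add \<Rightarrow> 'v) \<Rightarrow> 'g measure \<Rightarrow> ('g \<Rightarrow> 'v) \<Rightarrow> 'v" where
  "vec_integral smul \<mu> F =
    (\<Sum>w \<in> F ` space \<mu> - {0}. smul (complex_of_real (measure \<mu> {g \<in> space \<mu>. F g = w})) w)"

text \<open>
  The operator \<open>\<pi>(f)\<close> for a locally constant, compactly supported \<open>f\<close>; smoothness of \<open>\<pi>\<close> makes
  the integrand locally constant.
\<close>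

definition rep_op ::
    "(complex \<Rightarrow> 'v::ab_group_add \<Rightarrow> 'v) \<Rightarrow> 'g measure \<Rightarrow> ('g \<Rightarrow> 'v \<Rightarrow> 'v) \<Rightarrow>
      ('g \<Rightarrow> complex) \<Rightarrow> 'v \<Rightarrow> 'v" where
  "rep_op smul \<mu> \<pi> f v = vec_integral smul \<mu> (\<lambda>g. smul (f g) (\<pi> g v))"

definition segment :: "int set \<Rightarrow> bool" where
  "segment l \<longleftrightarrow> (\<exists>m n. m \<le> n \<and> l = {m..n})"

text \<open>For \<open>l = {m..n}\<close> with \<open>m \<le> n\<close>, the endpoints are \<open>m = Min l\<close> and \<open>n = Max l\<close>.\<close>

definition seg_order :: "int set \<Rightarrow> ('k::nonarch_local_field^2^2) set" where
  "seg_order l =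
    {A. A$1$1 \<in> ring_of_integers \<and> A$1$2 \<in> max_ideal_pow (- Min l) \<and>
        A$2$1 \<in> max_ideal_pow (Max l) \<and> A$2$2 \<in> ring_of_integers}"

definition seg_order_units :: "int set \<Rightarrow> ('k::nonarch_local_field^2^2) set" where
  "seg_order_units l =
    {A \<in> seg_order l. \<exists>B\<in>seg_order l. A ** B = mat 1 \<and> B ** A = mat 1}"

definition seg_subgroup ::
    "('k::nonarch_local_field^2^2) set \<Rightarrow> int set \<Rightarrow> ('k^2^2) set" where
  "seg_subgroup G l = seg_order_units l \<inter> G"

definition seg_idem ::
    "('k::nonarch_local_field^2^2) set \<Rightarrow> ('k^2^2) measure \<Rightarrow>
      (complex \<Rightarrow> 'v::ab_group_add \<Rightarrow> 'v) \<Rightarrow> ('k^2^2 \<Rightarrow> 'v \<Rightarrow> 'v) \<Rightarrow> int set \<Rightarrow> 'v \<Rightarrow> 'v" where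
  "seg_idem G \<mu> smul \<pi> l =
    rep_op smul \<mu> \<pi>
      (\<lambda>g. inverse (complex_of_real (measure \<mu> (seg_subgroup G l))) *
        indicator (seg_subgroup G l) g)"

end

theory Submission
  imports Defs
begin

text \<open>
  Since the stabilizer of a vector \<open>v\<close> is open and \<open>K\<^sub>\<ell>\<close> is compact, \<open>v\<close> has a finite \<open>K\<^sub>\<ell>\<close>-orbit,
  and left invariance of the Haar measure shows that \<open>e\<^sub>\<ell> v\<close> is the plain average of this orbit.
  In each of the three cases \<open>K\<close> of \<open>\<ell> \<inter> \<ell>'\<close> is the product set of \<open>K\<close> of \<open>\<ell>\<close> and \<open>K\<close> of \<open>\<ell>'\<close>:
  for nested segments one factor contains the other, and if the intersection has at least two
  elements, then the diagonal entries of its matrices are units, so that these matrices factor into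
  a unipotent and a triangular matrix. Averaging over orbits turns such a factorization into a
  composition.
\<close>

section \<open>Orbit averages for groups of linear operators\<close>

locale operator_group = vector_space smul
  for smul :: "complex \<Rightarrow> 'v::ab_group_add \<Rightarrow> 'v" +
  fixes P :: "('v \<Rightarrow> 'v) set"
  assumes linear_op: "f \<in> P \<Longrightarrow> Vector_Spaces.linear smul smul f"
    and id_op: "id \<in> P"
    and comp_op: "f \<in> P \<Longrightarrow> g \<in> P \<Longrightarrow> f \<circ> g \<in> P"
    and inv_op: "f \<in> P \<Longrightarrow> \<exists>g\<in>P. g \<circ> f = id"

definition orbit_of :: "('v \<Rightarrow> 'v) set \<Rightarrow> 'v \<Rightarrow> 'v set" where
  "orbit_of P v = (\<lambda>f. f v) ` P"

text \<open>Averaging runs over the orbit and not over the group, so it makes sense for an infinite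
  group with finite orbits. An infinite orbit has \<open>card\<close> 0 and a default sum 0, so the
  results about averages carry a finiteness hypothesis.\<close>

definition orbit_avg :: "(complex \<Rightarrow> 'v::ab_group_add \<Rightarrow> 'v) \<Rightarrow> ('v \<Rightarrow> 'v) set \<Rightarrow> 'v \<Rightarrow> 'v" where
  "orbit_avg smul P v = smul (1 / of_nat (card (orbit_of P v))) (\<Sum>w\<in>orbit_of P v. w)"

context operator_group
begin

lemma op_scale: "f \<in> P \<Longrightarrow> f (smul c x) = smul c (f x)"
  using linear_op by (simp add: linear_iff_module_hom module_hom.scale)

lemma op_sum: "f \<in> P \<Longrightarrow> f (sum h S) = (\<Sum>x\<in>S. f (h x))"
  using linear_op module_hom.sum[of smul smul f h S] by (simp add: linear_iff_module_hom)

lemma inj_op: "f \<in> P \<Longrightarrow> inj f"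
  by (metis inv_op inj_on_id inj_on_imageI2)

lemma orbit_of_self: "v \<in> orbit_of P v"
  unfolding orbit_of_def using id_op image_eqI[of v "\<lambda>f. f v" id P] by simp

lemma op_orbit_of:
  assumes "f \<in> P" "w \<in> orbit_of P v"
  shows "f w \<in> orbit_of P v"
proof -
  obtain g where "g \<in> P" "w = g v"
    using assms(2) by (auto simp: orbit_of_def)
  then have "f \<circ> g \<in> P" "f w = (f \<circ> g) v"
    using assms(1) comp_op by simp_all
  then show ?thesis
    unfolding orbit_of_def by blast
qed

text \<open>An inverse operator carries \<open>w\<close> back to \<open>v\<close>, so each of the
  two orbits contains the base point of the other.\<close>

lemma orbit_of_eq:
  assumes "w \<in> orbit_of P v"
  shows "orbit_of P w = orbit_of P v"
proof -
  obtain f where f: "f \<in> P" "w = f v"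
    using assms by (auto simp: orbit_of_def)
  obtain g where g: "g \<in> P" "g \<circ> f = id"
    using inv_op f by blast
  have "v = g w"
    using g f by (metis comp_apply id_apply)
  then have "v \<in> orbit_of P w"
    using g by (auto simp: orbit_of_def)
  then show ?thesis
    using assms op_orbit_of by (force simp: orbit_of_def)
qed

text \<open>An operator of the group is injective and maps the finite orbit into itself, so it
  permutes the orbit and merely reindexes the sum.\<close>

lemma op_orbit_avg:
  assumes f: "f \<in> P" and fin: "finite (orbit_of P v)"
  shows "f (orbit_avg smul P v) = orbit_avg smul P v"
proof -
  have inj: "inj_on f (orbit_of P v)"
    using inj_op[OF f] by (auto intro: inj_on_subset)
  have "f ` orbit_of P v = orbit_of P v"
    using op_orbit_of[OF f] by (intro endo_inj_surj[OF fin _ inj]) auto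
  then have "(\<Sum>w\<in>orbit_of P v. f w) = (\<Sum>w\<in>orbit_of P v. w)"
    using sum.reindex[OF inj, of "\<lambda>w. w"] by simp
  then show ?thesis
    by (simp add: orbit_avg_def op_scale[OF f] op_sum[OF f])
qed

text \<open>
  On vectors supported in a finite invariant set \<open>X\<close> the group acts through the finite set of its
  restrictions to \<open>X\<close>, and averaging over that set is visibly linear.
\<close>

lemma orbit_avg_sum:
  fixes X S v
  defines "Q \<equiv> (\<lambda>f. restrict f X) ` P"
  assumes fin: "finite X" and inv: "\<And>f x. f \<in> P \<Longrightarrow> x \<in> X \<Longrightarrow> f x \<in> X" and S: "S \<subseteq> X"
  shows "orbit_avg smul P (\<Sum>w\<in>S. smul c w) =
    smul (1 / of_nat (card Q)) (\<Sum>q\<in>Q. \<Sum>w\<in>S. smul c (q w))"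
proof -
  define T where "T = (\<Sum>w\<in>S. smul c w)"
  define \<phi> where "\<phi> q = (\<Sum>w\<in>S. smul c (q w))" for q :: "'v \<Rightarrow> 'v"
  define F where "F y = {q \<in> Q. \<phi> q = y}" for y
  \<comment> \<open>Because \<open>S\<close> lies in \<open>X\<close>, the restriction of
    \<open>f\<close> still determines \<open>f T\<close>, although \<open>T\<close> itself need not
    belong to \<open>X\<close>.\<close>
  have \<phi>: "\<phi> (restrict f X) = f T" if "f \<in> P" for f
    using that S by (auto simp: \<phi>_def T_def op_sum op_scale intro!: sum.cong)
  have "Q \<subseteq> X \<rightarrow>\<^sub>E X"
    using inv by (auto simp: Q_def)
  then have finQ: "finite Q"
    using fin by (meson finite_PiE finite_subset)
  have Qne: "Q \<noteq> {}"
    using id_op by (auto simp: Q_def)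
  have orb: "orbit_of P T = \<phi> ` Q"
    unfolding Q_def orbit_of_def image_image using \<phi> by (intro image_cong) auto
  \<comment> \<open>Composing with \<open>f\<close> on the left maps the fibre over \<open>y\<close>
    injectively into the fibre over \<open>f y\<close>. Used for \<open>f\<close> and for its
    inverse, this makes all fibres over the orbit of \<open>T\<close> equally large.\<close>
  have card_le: "card (F y) \<le> card (F (f y))" if f: "f \<in> P" for f y
  proof (rule card_inj_on_le)
    let ?s = "\<lambda>q. restrict (f \<circ> q) X"
    have ext: "q \<in> extensional X" if "q \<in> Q" for q
      using that by (auto simp: Q_def)
    show "inj_on ?s (F y)"
    proof (rule inj_onI)
      fix p q assume pq: "p \<in> F y" "q \<in> F y" "?s p = ?s q"
      show "p = q"
      proof (rule extensionalityI)
        show "p \<in> extensional X" "q \<in> extensional X"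
          using pq ext by (auto simp: F_def)
        fix x assume "x \<in> X"
        then have "f (p x) = f (q x)"
          using fun_cong[OF pq(3), of x] by simp
        then show "p x = q x"
          using inj_op[OF f] by (simp add: inj_eq)
      qed
    qed
    have "?s q \<in> F (f y)" if "q \<in> F y" for q
    proof -
      obtain g where g: "g \<in> P" "q = restrict g X"
        using \<open>q \<in> F y\<close> by (auto simp: F_def Q_def)
      have s: "?s q = restrict (f \<circ> g) X"
        using g by auto
      have "f \<circ> g \<in> P"
        using f g comp_op by blast
      then have "?s q \<in> Q"
        unfolding s by (auto simp: Q_def)
      moreover have "\<phi> (?s q) = f y"
        using \<phi>[OF \<open>f \<circ> g \<in> P\<close>] \<phi>[OF g(1)] that g unfolding s by (simp add: F_def)
      ultimately show ?thesis
        by (simp add: F_def)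
    qed
    then show "?s ` F y \<subseteq> F (f y)"
      by blast
    show "finite (F (f y))"
      using finQ by (simp add: F_def)
  qed
  have card_F: "card (F y) = card (F T)" if y: "y \<in> \<phi> ` Q" for y
  proof -
    obtain f where f: "f \<in> P" "y = f T"
      using y \<phi> by (auto simp: Q_def)
    obtain g where g: "g \<in> P" "g \<circ> f = id"
      using f inv_op by blast
    have "g y = T"
      using f g by (metis comp_apply id_apply)
    then show ?thesis
      using card_le[OF f(1), of T] card_le[OF g(1), of y] f by simp
  qed
  define N where "N = card (F T)"
  \<comment> \<open>Grouping by fibres counts every element of the orbit \<open>N\<close> times, in
    the sum as well as in \<open>card Q\<close>, so \<open>N\<close> cancels from the
    quotient.\<close>
  have "(\<Sum>q\<in>Q. \<phi> q) = (\<Sum>y\<in>\<phi> ` Q. \<Sum>q\<in>F y. \<phi> q)"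
    unfolding F_def using finQ by (rule sum.image_gen)
  also have "\<dots> = (\<Sum>y\<in>\<phi> ` Q. smul (of_nat N) y)"
  proof (rule sum.cong[OF refl])
    fix y assume y: "y \<in> \<phi> ` Q"
    have "(\<Sum>q\<in>F y. \<phi> q) = (\<Sum>q\<in>F y. smul 1 y)"
      by (intro sum.cong) (auto simp: F_def)
    also have "\<dots> = smul (\<Sum>q\<in>F y. 1) y"
      by (simp only: scale_sum_left)
    finally show "(\<Sum>q\<in>F y. \<phi> q) = smul (of_nat N) y"
      using card_F[OF y] by (simp add: N_def)
  qed
  also have "\<dots> = smul (of_nat N) (\<Sum>y\<in>\<phi> ` Q. y)"
    by (simp add: scale_sum_right)
  finally have sumQ: "(\<Sum>q\<in>Q. \<phi> q) = smul (of_nat N) (\<Sum>y\<in>\<phi> ` Q. y)" .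
  have "card Q = (\<Sum>y\<in>\<phi> ` Q. card (F y))"
    unfolding F_def card_eq_sum using finQ by (rule sum.image_gen)
  also have "\<dots> = card (\<phi> ` Q) * N"
    using card_F by (simp add: N_def)
  finally have cardQ: "card Q = card (\<phi> ` Q) * N" .
  have "card Q \<noteq> 0"
    using finQ Qne by simp
  then have "N \<noteq> 0"
    using cardQ by auto
  then have "smul (1 / of_nat (card Q)) (\<Sum>q\<in>Q. \<phi> q) =
      smul (1 / of_nat (card (\<phi> ` Q))) (\<Sum>y\<in>\<phi> ` Q. y)"
    by (simp add: sumQ cardQ)
  then show ?thesis
    unfolding orbit_avg_def T_def[symmetric] orb \<phi>_def by simp
qed

text \<open>By \<open>orbit_avg_sum\<close> the averaging passes through the sum over
  \<open>S\<close>. Every \<open>w\<close> in \<open>S\<close> has the same orbit as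
  \<open>v\<close>, so all the resulting terms agree.\<close>

lemma orbit_avg_average:
  assumes fin: "finite (orbit_of P v)" and S: "S \<subseteq> orbit_of P v" "S \<noteq> {}"
  shows "orbit_avg smul P (smul (1 / of_nat (card S)) (\<Sum>w\<in>S. w)) = orbit_avg smul P v"
proof -
  let ?X = "orbit_of P v"
  let ?Q = "(\<lambda>f. restrict f ?X) ` P"
  let ?n = "of_nat (card S) :: complex"
  have finS: "finite S"
    using S fin finite_subset by blast
  have n: "?n \<noteq> 0"
    using finS S by simp
  have avg: "orbit_avg smul P w = smul (1 / of_nat (card ?Q)) (\<Sum>q\<in>?Q. q w)" if "w \<in> ?X" for w
    using orbit_avg_sum[OF fin, of "{w}" 1] op_orbit_of that by simp
  have avg_eq: "orbit_avg smul P w = orbit_avg smul P v" if "w \<in> ?X" for w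
    using orbit_of_eq[OF that] by (simp add: orbit_avg_def)
  have "orbit_avg smul P (smul (1 / ?n) (\<Sum>w\<in>S. w)) =
      orbit_avg smul P (\<Sum>w\<in>S. smul (1 / ?n) w)"
    by (simp add: scale_sum_right)
  also have "\<dots> = smul (1 / of_nat (card ?Q)) (\<Sum>q\<in>?Q. \<Sum>w\<in>S. smul (1 / ?n) (q w))"
    using op_orbit_of S by (intro orbit_avg_sum[OF fin]) auto
  also have "\<dots> = smul (1 / of_nat (card ?Q)) (\<Sum>w\<in>S. \<Sum>q\<in>?Q. smul (1 / ?n) (q w))"
    by (subst sum.swap) simp
  also have "\<dots> = (\<Sum>w\<in>S. smul (1 / ?n) (smul (1 / of_nat (card ?Q)) (\<Sum>q\<in>?Q. q w)))"
    by (simp add: scale_sum_right mult.commute)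
  also have "\<dots> = (\<Sum>w\<in>S. smul (1 / ?n) (orbit_avg smul P v))"
    using S avg avg_eq by (intro sum.cong) (auto simp: subset_iff)
  also have "\<dots> = smul (\<Sum>w\<in>S. 1 / ?n) (orbit_avg smul P v)"
    by (simp only: scale_sum_left)
  also have "\<dots> = orbit_avg smul P v"
    using n by simp
  finally show ?thesis .
qed

end

text \<open>
  The vector \<open>orbit_avg smul H v\<close> is fixed by \<open>H\<close>, so it has the same orbit under \<open>K\<close> as under \<open>K H\<close>.
\<close>

lemma orbit_avg_orbit_avg:
  assumes K: "operator_group smul K" and H: "operator_group smul H" and M: "operator_group smul M"
    and prod: "M = {f \<circ> g | f g. f \<in> K \<and> g \<in> H}"
    and fin: "finite (orbit_of M v)"
  shows "orbit_avg smul K (orbit_avg smul H v) = orbit_avg smul M v"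
proof -
  interpret K: operator_group smul K by fact
  interpret H: operator_group smul H by fact
  interpret M: operator_group smul M by fact
  define T where "T = orbit_avg smul H v"
  have "H \<subseteq> M"
  proof
    fix g assume "g \<in> H"
    moreover have "g = id \<circ> g"
      by simp
    ultimately show "g \<in> M"
      unfolding prod using K.id_op by blast
  qed
  then have sub: "orbit_of H v \<subseteq> orbit_of M v"
    by (auto simp: orbit_of_def)
  then have "finite (orbit_of H v)"
    using fin finite_subset by blast
  then have fix_T: "h T = T" if "h \<in> H" for h
    using that H.op_orbit_avg by (simp add: T_def)
  have "orbit_of M T = orbit_of K T"
  proof
    show "orbit_of M T \<subseteq> orbit_of K T"
    proof
      fix y assume "y \<in> orbit_of M T"
      then obtain f g where fg: "f \<in> K" "g \<in> H" "y = f (g T)"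
        by (auto simp: orbit_of_def prod)
      then show "y \<in> orbit_of K T"
        using fix_T[OF fg(2)] by (simp add: orbit_of_def)
    qed
    have "K \<subseteq> M"
    proof
      fix f assume "f \<in> K"
      moreover have "f = f \<circ> id"
        by simp
      ultimately show "f \<in> M"
        unfolding prod using H.id_op by blast
    qed
    then show "orbit_of K T \<subseteq> orbit_of M T"
      by (auto simp: orbit_of_def)
  qed
  then have "orbit_avg smul K T = orbit_avg smul M T"
    by (simp add: orbit_avg_def)
  \<comment> \<open>\<open>T\<close> is itself the equal-weight mean of the \<open>H\<close>-orbit
    of \<open>v\<close>, a nonempty part of the \<open>M\<close>-orbit, so
    \<open>orbit_avg_average\<close> applies.\<close>
  also have "\<dots> = orbit_avg smul M v"
    unfolding T_def orbit_avg_def[of smul H]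
    using sub H.orbit_of_self by (intro M.orbit_avg_average[OF fin]) auto
  finally show ?thesis
    by (simp add: T_def)
qed

section \<open>Absolute value and topology of a non-archimedean local field\<close>

lemma abs_val_0 [simp]: "abs_val (0 :: 'k::nonarch_local_field) = 0"
  using dist_abs_val[of "0 :: 'k" 0] by simp

lemma abs_val_eq_0_iff [simp]: "abs_val x = 0 \<longleftrightarrow> x = (0 :: 'k::nonarch_local_field)"
  using dist_abs_val[of x 0] by auto

lemma abs_val_nonneg [simp]: "abs_val (x :: 'k::nonarch_local_field) \<ge> 0"
  using dist_abs_val[of x 0] by (metis diff_zero zero_le_dist)

lemma abs_val_1 [simp]: "abs_val (1 :: 'k::nonarch_local_field) = 1"
  using abs_val_mult[of "1 :: 'k" 1] by simp

lemma abs_val_minus [simp]: "abs_val (- x) = abs_val (x :: 'k::nonarch_local_field)"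
  by (metis diff_0 diff_0_right dist_abs_val dist_commute)

lemma abs_val_diff: "abs_val (x - y) \<le> max (abs_val x) (abs_val (y :: 'k::nonarch_local_field))"
  using abs_val_ultrametric[of x "- y"] by simp

lemma abs_val_inverse: "abs_val (inverse x) = inverse (abs_val (x :: 'k::nonarch_local_field))"
proof (cases "x = 0")
  case False
  then have "abs_val x * abs_val (inverse x) = 1"
    using abs_val_mult[of x "inverse x"] by simp
  then show ?thesis
    by (metis inverse_unique)
qed simp

lemma abs_val_divide: "abs_val (x / y) = abs_val x / abs_val (y :: 'k::nonarch_local_field)"
  by (simp add: divide_inverse abs_val_mult abs_val_inverse)

lemma abs_val_power: "abs_val (x ^ n) = abs_val (x :: 'k::nonarch_local_field) ^ n"
  by (induction n) (simp_all add: abs_val_mult)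

lemma abs_val_power_int: "abs_val (x powi i) = abs_val (x :: 'k::nonarch_local_field) powi i"
  by (simp add: power_int_def abs_val_power abs_val_inverse)

text \<open>The isosceles principle: writing \<open>x\<close> as \<open>(x + y) - y\<close> gives
  the bound from below, since \<open>y\<close> is too small to attain the maximum.\<close>

lemma abs_val_add_eq:
  assumes "abs_val y < abs_val (x :: 'k::nonarch_local_field)"
  shows "abs_val (x + y) = abs_val x"
  using abs_val_ultrametric[of x y] abs_val_diff[of "x + y" y] assms by auto

text \<open>The class provides a field and a metric; continuity of the field operations has to be
  derived from the absolute value, and this is the translation used.\<close>

lemma tendsto_iff_abs_val:
  fixes f :: "'a \<Rightarrow> 'k::nonarch_local_field"
  shows "(f \<longlongrightarrow> a) F \<longleftrightarrow> ((\<lambda>x. abs_val (f x - a)) \<longlongrightarrow> 0) F"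
  by (simp add: tendsto_dist_iff[of f a F] dist_abs_val)

lemma tendsto_add_lf:
  fixes f g :: "'a \<Rightarrow> 'k::nonarch_local_field"
  assumes "(f \<longlongrightarrow> a) F" "(g \<longlongrightarrow> b) F"
  shows "((\<lambda>x. f x + g x) \<longlongrightarrow> a + b) F"
  unfolding tendsto_iff_abs_val
proof (rule tendsto_sandwich[OF _ _ tendsto_const])
  show "((\<lambda>x. max (abs_val (f x - a)) (abs_val (g x - b))) \<longlongrightarrow> 0) F"
    using tendsto_max[OF assms[unfolded tendsto_iff_abs_val]] by simp
  show "\<forall>\<^sub>F x in F. abs_val (f x + g x - (a + b)) \<le> max (abs_val (f x - a)) (abs_val (g x - b))"
    using abs_val_ultrametric[of "f x - a" "g x - b" for x] by (simp add: algebra_simps)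
qed simp

lemma tendsto_mult_lf:
  fixes f g :: "'a \<Rightarrow> 'k::nonarch_local_field"
  assumes "(f \<longlongrightarrow> a) F" "(g \<longlongrightarrow> b) F"
  shows "((\<lambda>x. f x * g x) \<longlongrightarrow> a * b) F"
  unfolding tendsto_iff_abs_val
proof (rule tendsto_sandwich[OF _ _ tendsto_const])
  let ?f = "\<lambda>x. abs_val (f x - a)" and ?g = "\<lambda>x. abs_val (g x - b)"
  let ?h = "\<lambda>x. max (?f x * ?g x) (max (abs_val a * ?g x) (?f x * abs_val b))"
  have fg: "(?f \<longlongrightarrow> 0) F" "(?g \<longlongrightarrow> 0) F"
    using assms by (simp_all add: tendsto_iff_abs_val)
  have "(?h \<longlongrightarrow> max (0 * 0) (max (abs_val a * 0) (0 * abs_val b))) F"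
    by (intro tendsto_max tendsto_mult fg tendsto_const)
  then show "(?h \<longlongrightarrow> 0) F"
    by simp
  have "abs_val (f x * g x - a * b) \<le> ?h x" for x
  proof -
    \<comment> \<open>Expansion around the limits: every summand contains a factor that tends to
      0.\<close>
    have *: "f x * g x - a * b = (f x - a) * (g x - b) + (a * (g x - b) + (f x - a) * b)"
      by (simp add: algebra_simps)
    show ?thesis
      unfolding * abs_val_mult[symmetric]
      by (meson abs_val_ultrametric max.mono order.refl order_trans)
  qed
  then show "\<forall>\<^sub>F x in F. abs_val (f x * g x - a * b) \<le> ?h x"
    by simp
qed simp

lemma continuous_on_add_lf:
  fixes f g :: "'a::topological_space \<Rightarrow> 'k::nonarch_local_field"
  shows "continuous_on S f \<Longrightarrow> continuous_on S g \<Longrightarrow> continuous_on S (\<lambda>x. f x + g x)"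
  unfolding continuous_on_def by (auto intro: tendsto_add_lf)

lemma continuous_on_mult_lf:
  fixes f g :: "'a::topological_space \<Rightarrow> 'k::nonarch_local_field"
  shows "continuous_on S f \<Longrightarrow> continuous_on S g \<Longrightarrow> continuous_on S (\<lambda>x. f x * g x)"
  unfolding continuous_on_def by (auto intro: tendsto_mult_lf)

lemma continuous_on_abs_val:
  fixes f :: "'a::topological_space \<Rightarrow> 'k::nonarch_local_field"
  shows "continuous_on S f \<Longrightarrow> continuous_on S (\<lambda>x. abs_val (f x))"
  using continuous_on_dist[of S f "\<lambda>_. 0"] by (simp add: dist_abs_val)

lemma continuous_on_det2: "continuous_on S (det :: 'k::nonarch_local_field^2^2 \<Rightarrow> 'k)"
proof -
  have "continuous_on S (\<lambda>A :: 'k^2^2. A$1$1 * A$2$2 + (- 1) * (A$1$2 * A$2$1))"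
    by (intro continuous_on_add_lf continuous_on_mult_lf continuous_on_const
        continuous_on_component continuous_on_id)
  then show ?thesis
    by (simp add: det_2 cong: continuous_on_cong)
qed

lemma continuous_on_matrix_mult2:
  fixes f g :: "'a::topological_space \<Rightarrow> 'k::nonarch_local_field^2^2"
  assumes "continuous_on S f" "continuous_on S g"
  shows "continuous_on S (\<lambda>x. f x ** g x)"
  unfolding matrix_matrix_mult_def sum_2
  by (intro continuous_on_vec_lambda continuous_on_add_lf continuous_on_mult_lf
      continuous_on_component assms)

lemma closed_abs_val_le: "closed {x :: 'k::nonarch_local_field. abs_val x \<le> r}"
  by (intro closed_Collect_le continuous_on_abs_val continuous_on_id continuous_on_const)

text \<open>By the ultrametric inequality the ball of radius \<open>r\<close> around any point of
  this set stays inside the set.\<close>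

lemma open_abs_val_le:
  assumes "r > 0"
  shows "open {x :: 'k::nonarch_local_field. abs_val x \<le> r}"
  unfolding open_dist
proof (intro ballI exI conjI allI impI)
  fix x y :: 'k assume "x \<in> {x. abs_val x \<le> r}" "dist y x < r"
  then show "y \<in> {x. abs_val x \<le> r}"
    using abs_val_ultrametric[of "y - x" x] by (simp add: dist_abs_val)
qed (use assms in simp)

lemma open_abs_val_1: "open {x :: 'k::nonarch_local_field. abs_val x = 1}"
  unfolding open_dist
proof (intro ballI exI conjI allI impI)
  fix x y :: 'k assume "x \<in> {x. abs_val x = 1}" "dist y x < 1"
  then show "y \<in> {x. abs_val x = 1}"
    using abs_val_add_eq[of "y - x" x] by (simp add: dist_abs_val)
qed simp

lemma ex_small_abs_val: "\<exists>x :: 'k::nonarch_local_field. 0 < abs_val x \<and> abs_val x < 1"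
proof -
  obtain x :: 'k where x: "x \<noteq> 0" "abs_val x \<noteq> 1"
    using abs_val_nontrivial by blast
  have pos: "abs_val x > 0"
    using x by (simp add: order_less_le)
  show ?thesis
  proof (cases "abs_val x < 1")
    case False
    then have "abs_val (inverse x) < 1"
      using x by (simp add: abs_val_inverse inverse_less_1_iff)
    then show ?thesis
      using pos by (intro exI[of _ "inverse x"]) (simp add: abs_val_inverse)
  qed (use pos in blast)
qed

lemma ex_abs_val_less:
  assumes "r > 0"
  shows "\<exists>x :: 'k::nonarch_local_field. 0 < abs_val x \<and> abs_val x < r"
proof -
  obtain x :: 'k where x: "0 < abs_val x" "abs_val x < 1"
    using ex_small_abs_val by blast
  obtain n where "abs_val x ^ n < r"
    using real_arch_pow_inv[OF assms x(2)] by blast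
  then show ?thesis
    using x by (intro exI[of _ "x ^ n"]) (simp add: abs_val_power del: abs_val_eq_0_iff)
qed

text \<open>Local compactness gives a compact neighbourhood of 0. A small scalar \<open>x\<close>
  shrinks the ball into it, and multiplication by \<open>inverse x\<close>, which is continuous,
  carries the compact image back.\<close>

lemma compact_abs_val_le: "compact {x :: 'k::nonarch_local_field. abs_val x \<le> r}"
proof -
  obtain U C where UC: "open U" "(0 :: 'k) \<in> U" "U \<subseteq> C" "compact C"
    using locally_compact[of "0 :: 'k"] by blast
  obtain e where e: "e > 0" "\<And>y :: 'k. dist y 0 < e \<Longrightarrow> y \<in> U"
    using UC unfolding open_dist by blast
  \<comment> \<open>The divisor \<open>max r 1\<close> is positive for every \<open>r\<close>,
    including \<open>r <= 0\<close>.\<close>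
  obtain x :: 'k where x: "0 < abs_val x" "abs_val x < e / max r 1"
    using ex_abs_val_less[of "e / max r 1"] e by auto
  have x_bound: "abs_val x * r < e"
  proof -
    have "abs_val x * r \<le> abs_val x * max r 1"
      by (simp add: mult_left_mono)
    also have "\<dots> < e"
      using x by (simp add: pos_less_divide_eq)
    finally show ?thesis .
  qed
  have x0: "x \<noteq> 0"
    using x by auto
  let ?B = "{y. abs_val y \<le> abs_val x * r}"
  have "?B \<subseteq> C"
    using e x_bound UC by (auto simp: dist_abs_val)
  then have "compact (C \<inter> ?B)" "C \<inter> ?B = ?B"
    using UC closed_abs_val_le by auto
  then have "compact ((\<lambda>y. inverse x * y) ` ?B)"
    by (intro compact_continuous_image continuous_on_mult_lf continuous_on_const continuous_on_id)
      simp
  also have "(\<lambda>y. inverse x * y) ` ?B = {x. abs_val x \<le> r}"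
  proof (intro equalityI subsetI)
    fix y :: 'k assume "y \<in> {x. abs_val x \<le> r}"
    then show "y \<in> (\<lambda>y. inverse x * y) ` ?B"
      using x x0 by (intro image_eqI[of _ _ "x * y"]) (auto simp: abs_val_mult)
  next
    fix y assume "y \<in> (\<lambda>y. inverse x * y) ` ?B"
    then show "y \<in> {x. abs_val x \<le> r}"
      using x(1) by (auto simp: abs_val_divide divide_simps mult.commute)
  qed
  finally show ?thesis .
qed

text \<open>The maximal ideal is compact, being the unit ball without the open unit sphere, so
  \<open>abs_val\<close> attains a maximum on it. An element \<open>u\<close> where this happens
  divides all others.\<close>

lemma ex_uniformizer:
  "\<exists>u :: 'k::nonarch_local_field. 0 < abs_val u \<and> abs_val u < 1 \<and> max_ideal = (*) u ` ring_of_integers"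
proof -
  have "{x :: 'k. abs_val x < 1} = {x. abs_val x \<le> 1} \<inter> - {x. abs_val x = 1}"
    by auto
  also have "compact \<dots>"
    by (intro compact_Int_closed compact_abs_val_le closed_Compl open_abs_val_1)
  finally have "compact {x :: 'k. abs_val x < 1}" .
  moreover have "{x :: 'k. abs_val x < 1} \<noteq> {}"
    using ex_small_abs_val by blast
  ultimately obtain u :: 'k where u: "abs_val u < 1" "\<And>x :: 'k. abs_val x < 1 \<Longrightarrow> abs_val x \<le> abs_val u"
    using continuous_attains_sup[of "{x :: 'k. abs_val x < 1}" abs_val]
      continuous_on_abs_val[OF continuous_on_id] by auto
  have pos: "0 < abs_val u"
    using u ex_small_abs_val by fastforce
  then have u0: "u \<noteq> 0"
    by auto
  have "max_ideal = (*) u ` ring_of_integers"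
  proof (intro equalityI subsetI)
    fix x :: 'k assume "x \<in> max_ideal"
    then show "x \<in> (*) u ` ring_of_integers"
      using u pos u0 by (intro image_eqI[of _ _ "x / u"])
        (auto simp: max_ideal_def ring_of_integers_def abs_val_divide)
  next
    fix x assume "x \<in> (*) u ` ring_of_integers"
    then obtain y where y: "x = u * y" "abs_val y \<le> 1"
      by (auto simp: ring_of_integers_def)
    have "abs_val u * abs_val y \<le> abs_val u"
      using y by (simp add: mult_left_le)
    then show "x \<in> max_ideal"
      using u y by (simp add: max_ideal_def abs_val_mult)
  qed
  then show ?thesis
    using u pos by blast
qed

text \<open>With \<open>q\<close> the absolute value of a uniformizer, fractional ideals become
  balls, and from here on real radii replace ideals.\<close>

lemma ex_max_ideal_pow_eq:
  "\<exists>q > 0. q < 1 \<and> (\<forall>i. max_ideal_pow i = {x :: 'k::nonarch_local_field. abs_val x \<le> q powi i})"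
proof -
  obtain u :: 'k where u: "0 < abs_val u" "abs_val u < 1" "max_ideal = (*) u ` ring_of_integers"
    using ex_uniformizer by blast
  \<comment> \<open>Two generators divide each other. Hence the union over all generators in
    \<open>max_ideal_pow\<close> is a single ball.\<close>
  have eq: "abs_val w = abs_val u" if w: "max_ideal = (*) w ` ring_of_integers" for w :: 'k
  proof -
    have "u \<in> (*) w ` ring_of_integers" "w \<in> (*) u ` ring_of_integers"
      using w u by (force simp: ring_of_integers_def)+
    then obtain x y where xy: "u = w * x" "abs_val x \<le> 1" "w = u * y" "abs_val y \<le> 1"
      unfolding ring_of_integers_def by blast
    have "abs_val u \<le> abs_val w"
      unfolding xy(1) abs_val_mult using xy(2) by (simp add: mult_left_le)
    moreover have "abs_val w \<le> abs_val u"
      unfolding xy(3) abs_val_mult using xy(4) by (simp add: mult_left_le)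
    ultimately show ?thesis
      by simp
  qed
  have "max_ideal_pow i = {x :: 'k. abs_val x \<le> abs_val u powi i}" for i
  proof (intro equalityI subsetI)
    fix x :: 'k assume "x \<in> max_ideal_pow i"
    then obtain w y where w: "max_ideal = (*) w ` ring_of_integers"
      and y: "x = w powi i * y" "abs_val y \<le> 1"
      unfolding max_ideal_pow_def ring_of_integers_def by blast
    show "x \<in> {x. abs_val x \<le> abs_val u powi i}"
      using u(1) y eq[OF w] by (simp add: abs_val_mult abs_val_power_int mult_left_le)
  next
    fix x :: 'k assume x: "x \<in> {x. abs_val x \<le> abs_val u powi i}"
    have "u \<noteq> 0"
      using u by auto
    have "x = u powi i * (x / u powi i)"
      using \<open>u \<noteq> 0\<close> by (simp add: power_int_eq_0_iff)
    moreover have "x / u powi i \<in> ring_of_integers"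
      using x u by (simp add: ring_of_integers_def abs_val_divide abs_val_power_int del: abs_val_eq_0_iff)
    ultimately show "x \<in> max_ideal_pow i"
      unfolding max_ideal_pow_def using u by blast
  qed
  then show ?thesis
    using u by blast
qed

section \<open>Two by two matrices, and unit groups of orders as boxes\<close>

definition mat2 :: "'a \<Rightarrow> 'a \<Rightarrow> 'a \<Rightarrow> 'a \<Rightarrow> 'a^2^2" where
  "mat2 a b c d = (\<chi> i j. if i = 1 then if j = 1 then a else b else if j = 1 then c else d)"

lemma mat2_nth [simp]:
  "mat2 a b c d $ 1 $ 1 = a" "mat2 a b c d $ 1 $ 2 = b"
  "mat2 a b c d $ 2 $ 1 = c" "mat2 a b c d $ 2 $ 2 = d"
  by (simp_all add: mat2_def)

lemma matrix2_eq_iff: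
  "A = B \<longleftrightarrow> A$1$1 = B$1$1 \<and> A$1$2 = B$1$2 \<and> A$2$1 = B$2$1 \<and> A$2$2 = B$2$2" for A B :: "'a^2^2"
  by (auto simp: vec_eq_iff forall_2)

lemma matrix2_mult_nth: "(A ** B) $ i $ j = A$i$1 * B$1$j + A$i$2 * B$2$j"
  for A B :: "'a::semiring_1^2^2"
  by (simp add: matrix_matrix_mult_def sum_2)

lemma mat_1_2_nth [simp]:
  "(mat 1 :: 'a::zero_neq_one^2^2) $ 1 $ 1 = 1" "(mat 1 :: 'a^2^2) $ 1 $ 2 = 0"
  "(mat 1 :: 'a^2^2) $ 2 $ 1 = 0" "(mat 1 :: 'a^2^2) $ 2 $ 2 = 1"
  by (simp_all add: mat_def)

lemma mat2_adjugate:
  fixes A :: "'a::field^2^2"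
  assumes "det A \<noteq> 0"
  defines "B \<equiv> mat2 (A$2$2 / det A) (- A$1$2 / det A) (- A$2$1 / det A) (A$1$1 / det A)"
  shows "A ** B = mat 1" "B ** A = mat 1"
proof -
  define D where "D = det A"
  have D: "D \<noteq> 0" "A$1$1 * A$2$2 = D + A$1$2 * A$2$1"
    using assms(1) by (simp_all add: D_def det_2)
  show "A ** B = mat 1" "B ** A = mat 1"
    unfolding B_def D_def[symmetric] using D
    by (simp_all add: matrix2_eq_iff matrix2_mult_nth field_simps)
qed

text \<open>For \<open>r = q powi (- m)\<close> and \<open>s = q powi n\<close> this is the order of
  the segment \<open>{m..n}\<close>. Free real radii make the comparison of two segments a
  comparison of numbers.\<close>

definition order_box :: "real \<Rightarrow> real \<Rightarrow> ('k::nonarch_local_field^2^2) set" where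
  "order_box r s =
    {A. abs_val (A$1$1) \<le> 1 \<and> abs_val (A$1$2) \<le> r \<and> abs_val (A$2$1) \<le> s \<and> abs_val (A$2$2) \<le> 1}"

definition unit_box :: "real \<Rightarrow> real \<Rightarrow> ('k::nonarch_local_field^2^2) set" where
  "unit_box r s = {A \<in> order_box r s. abs_val (det A) = 1}"

lemma unit_box_mono: "r \<le> r' \<Longrightarrow> s \<le> s' \<Longrightarrow> unit_box r s \<subseteq> unit_box r' s'"
  by (auto simp: unit_box_def order_box_def)

lemma abs_val_mult_le:
  "abs_val x \<le> a \<Longrightarrow> abs_val y \<le> b \<Longrightarrow> a * b \<le> c \<Longrightarrow> abs_val (x * y) \<le> c"
  for x y :: "'k::nonarch_local_field"
  using mult_mono[of "abs_val x" a "abs_val y" b] order_trans[of 0 "abs_val x" a]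
  by (simp add: abs_val_mult)

lemma abs_val_add_le: "abs_val x \<le> c \<Longrightarrow> abs_val y \<le> c \<Longrightarrow> abs_val (x + y) \<le> c"
  for x y :: "'k::nonarch_local_field"
  using abs_val_ultrametric[of x y] by simp

lemma abs_val_diff_le: "abs_val x \<le> c \<Longrightarrow> abs_val y \<le> c \<Longrightarrow> abs_val (x - y) \<le> c"
  for x y :: "'k::nonarch_local_field"
  using abs_val_diff[of x y] by simp

text \<open>The bound \<open>r * s <= 1\<close> makes products of opposite off-diagonal entries
  integral.\<close>

lemma order_box_mult:
  assumes "r * s \<le> 1" "A \<in> order_box r s" "B \<in> order_box r s"
  shows "A ** B \<in> order_box r s"
  using assms
  by (auto simp: order_box_def matrix2_mult_nth mult.commute[of s r]
      intro!: abs_val_add_le intro: abs_val_mult_le)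

lemma abs_val_det_le:
  assumes "r * s \<le> 1" "A \<in> order_box r s"
  shows "abs_val (det A) \<le> 1"
  using assms
  by (auto simp: order_box_def det_2 intro!: abs_val_diff_le intro: abs_val_mult_le)

text \<open>Determinants on the order are integral and multiplicative, so those of mutually inverse
  elements are units. Conversely, the adjugate divided by a unit determinant obeys the same bounds
  as the matrix.\<close>

lemma order_box_units:
  assumes rs: "r * s \<le> 1" and A: "A \<in> order_box r s"
  shows "(\<exists>B\<in>order_box r s. A ** B = mat 1 \<and> B ** A = mat 1) \<longleftrightarrow> abs_val (det A) = 1"
proof
  assume "\<exists>B\<in>order_box r s. A ** B = mat 1 \<and> B ** A = mat 1"
  then obtain B where B: "B \<in> order_box r s" "A ** B = mat 1"
    by blast
  have "abs_val (det A) * abs_val (det B) = 1"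
    by (metis B(2) abs_val_1 abs_val_mult det_I det_mul)
  moreover have "abs_val (det A) \<le> 1" "abs_val (det B) \<le> 1"
    using abs_val_det_le rs A B by blast+
  ultimately show "abs_val (det A) = 1"
    using mult_left_le[of "abs_val (det B)" "abs_val (det A)"] by simp
next
  assume det: "abs_val (det A) = 1"
  have "det A \<noteq> 0"
    using det by auto
  define B where "B = mat2 (A$2$2 / det A) (- A$1$2 / det A) (- A$2$1 / det A) (A$1$1 / det A)"
  have "B \<in> order_box r s"
    using A det by (simp add: B_def order_box_def abs_val_divide)
  then show "\<exists>B\<in>order_box r s. A ** B = mat 1 \<and> B ** A = mat 1"
    using mat2_adjugate[OF \<open>det A \<noteq> 0\<close>] unfolding B_def by blast
qed

text \<open>The box is the continuous image of a product of four compact balls.\<close>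

lemma compact_order_box: "compact (order_box r s)"
proof -
  let ?B = "\<lambda>r. {x. abs_val x \<le> r}"
  let ?m = "\<lambda>(a, b, c, d). mat2 a b c d"
  have "continuous_on (?B 1 \<times> ?B r \<times> ?B s \<times> ?B 1) ?m"
    unfolding mat2_def case_prod_unfold
  proof (intro continuous_on_vec_lambda)
    fix i j :: 2
    show "continuous_on (?B 1 \<times> ?B r \<times> ?B s \<times> ?B 1)
      (\<lambda>p. if i = 1 then if j = 1 then fst p else fst (snd p)
           else if j = 1 then fst (snd (snd p)) else snd (snd (snd p)))"
      by (cases "i = 1"; cases "j = 1")
        (simp_all add: continuous_on_fst continuous_on_snd continuous_on_id)
  qed
  then have "compact (?m ` (?B 1 \<times> ?B r \<times> ?B s \<times> ?B 1))"
    by (intro compact_continuous_image compact_Times compact_abs_val_le)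
  also have "?m ` (?B 1 \<times> ?B r \<times> ?B s \<times> ?B 1) = order_box r s"
  proof (intro equalityI subsetI)
    fix A assume "A \<in> order_box r s"
    then show "A \<in> ?m ` (?B 1 \<times> ?B r \<times> ?B s \<times> ?B 1)"
      by (intro image_eqI[of _ _ "(A$1$1, A$1$2, A$2$1, A$2$2)"])
        (auto simp: order_box_def matrix2_eq_iff)
  qed (auto simp: order_box_def)
  finally show ?thesis .
qed

lemma unit_box_eq:
  "unit_box r s = order_box r s \<inter> det -` {x. abs_val x = 1}"
  by (auto simp: unit_box_def)

lemma open_unit_box:
  assumes "r > 0" "s > 0"
  shows "open (unit_box r s)"
proof -
  have entry: "open {A :: 'k::nonarch_local_field^2^2. abs_val (A $ i $ j) \<le> t}" if "t > 0" for i j t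
    using open_vimage[OF open_abs_val_le[OF that], of "\<lambda>A. A $ i $ j"]
    by (simp add: vimage_def continuous_on_component continuous_on_id)
  have "open (order_box r s)"
    unfolding order_box_def by (intro open_Collect_conj entry assms zero_less_one)
  then show ?thesis
    unfolding unit_box_eq
    by (intro open_Int open_vimage open_abs_val_1 continuous_on_det2)
qed

lemma compact_unit_box: "compact (unit_box r s :: ('k::nonarch_local_field^2^2) set)"
proof -
  have "closed {x :: 'k. abs_val x = 1}"
    by (intro closed_Collect_eq continuous_on_abs_val continuous_on_id continuous_on_const)
  then show ?thesis
    unfolding unit_box_eq
    by (intro compact_Int_closed compact_order_box closed_vimage continuous_on_det2)
qed

text \<open>The product of the two radii is \<open>q powi (n - m)\<close>, which is at most 1
  because \<open>m <= n\<close>; thus \<open>order_box_units\<close> identifies the unit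
  group.\<close>

lemma seg_subgroup_eq:
  assumes q: "0 < q" "q < 1" "\<And>i. max_ideal_pow i = {x :: 'k::nonarch_local_field. abs_val x \<le> q powi i}"
    and "m \<le> n"
  shows "seg_subgroup G {m..n} = unit_box (q powi (- m)) (q powi n) \<inter> (G :: ('k^2^2) set)"
proof -
  have "q powi (- m) * q powi n = q powi (n - m)"
    using q by (simp add: power_int_add[symmetric])
  also have "\<dots> \<le> 1"
    using q \<open>m \<le> n\<close> by (simp add: power_int_def power_le_one)
  finally have rs: "q powi (- m) * q powi n \<le> 1" .
  have "Min {m..n} = m" "Max {m..n} = n"
    using \<open>m \<le> n\<close> by (auto intro: Min_eqI Max_eqI)
  then have "(seg_order {m..n} :: ('k^2^2) set) = order_box (q powi (- m)) (q powi n)"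
    by (simp add: seg_order_def order_box_def q(3) ring_of_integers_def)
  then show ?thesis
    using order_box_units[OF rs] by (auto simp: seg_subgroup_def seg_order_units_def unit_box_def)
qed

text \<open>The product of the off-diagonal entries lies in the maximal ideal, so a unit determinant
  forces the product of the integral diagonal entries to be a unit.\<close>

lemma unit_box_diagonal:
  assumes "r * s < 1" "A \<in> unit_box r s"
  shows "abs_val (A$1$1) = 1" "abs_val (A$2$2) = 1"
proof -
  have A: "abs_val (A$1$1) \<le> 1" "abs_val (A$1$2) \<le> r" "abs_val (A$2$1) \<le> s" "abs_val (A$2$2) \<le> 1"
    and det: "abs_val (A$1$1 * A$2$2 - A$1$2 * A$2$1) = 1"
    using assms(2) by (auto simp: unit_box_def order_box_def det_2)
  have "abs_val (A$1$2 * A$2$1) < 1"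
    using abs_val_mult_le[OF A(2,3) order_refl] assms(1) by simp
  then have "1 \<le> abs_val (A$1$1) * abs_val (A$2$2)"
    using abs_val_diff[of "A$1$1 * A$2$2" "A$1$2 * A$2$1"] det
    by (auto simp: abs_val_mult)
  then show "abs_val (A$1$1) = 1" "abs_val (A$2$2) = 1"
    using A mult_left_le[of "abs_val (A$1$1)" "abs_val (A$2$2)"]
      mult_left_le[of "abs_val (A$2$2)" "abs_val (A$1$1)"]
    by (simp_all add: mult.commute)
qed

text \<open>One step of Gaussian elimination with the unit pivot \<open>A$1$1\<close>. Each factor
  has a zero off the diagonal, which satisfies any bound; this leaves \<open>r'\<close> and
  \<open>s'\<close> free.\<close>

lemma unit_box_lower_upper:
  assumes "r * s < 1" "A \<in> unit_box r s" "0 \<le> r'" "0 \<le> s'"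
  obtains L U where "A = L ** U" "det L = 1" "L \<in> unit_box r' s" "U \<in> unit_box r s'"
proof -
  define L where "L = mat2 1 0 (A$2$1 / A$1$1) 1"
  define U where "U = mat2 (A$1$1) (A$1$2) 0 (A$2$2 - A$2$1 * A$1$2 / A$1$1)"
  have A: "abs_val (A$1$2) \<le> r" "abs_val (A$2$1) \<le> s" "abs_val (det A) = 1"
    using assms(2) by (auto simp: unit_box_def order_box_def)
  have diag: "abs_val (A$1$1) = 1" "abs_val (A$2$2) = 1"
    using unit_box_diagonal[OF assms(1,2)] .
  then have a0: "A$1$1 \<noteq> 0"
    by auto
  have eq: "A = L ** U"
    using a0 by (simp add: L_def U_def matrix2_eq_iff matrix2_mult_nth)
  have detL: "det L = 1"
    by (simp add: L_def det_2)
  have L: "L \<in> unit_box r' s"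
    using diag A assms(3) detL by (simp add: unit_box_def order_box_def L_def abs_val_divide)
  have detU: "abs_val (det U) = 1"
    using A(3) detL unfolding eq det_mul by simp
  \<comment> \<open>The corner entry is read off from the determinant of the triangular matrix
    \<open>U\<close>, which avoids estimating its formula.\<close>
  then have "abs_val (U$2$2) = 1"
    using diag by (simp add: U_def det_2 abs_val_mult)
  then have "U \<in> unit_box r s'"
    using detU diag A assms(4) by (simp add: unit_box_def order_box_def U_def)
  then show thesis
    using that eq detL L by blast
qed

text \<open>The mirror image, with pivot \<open>A$2$2\<close>; it serves the case where the upper
  triangular factor has to stand on the left.\<close>

lemma unit_box_upper_lower:
  assumes "r * s < 1" "A \<in> unit_box r s" "0 \<le> r'" "0 \<le> s'"
  obtains U L where "A = U ** L" "det U = 1" "U \<in> unit_box r s'" "L \<in> unit_box r' s"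
proof -
  define U where "U = mat2 1 (A$1$2 / A$2$2) 0 1"
  define L where "L = mat2 (A$1$1 - A$1$2 * A$2$1 / A$2$2) 0 (A$2$1) (A$2$2)"
  have A: "abs_val (A$1$2) \<le> r" "abs_val (A$2$1) \<le> s" "abs_val (det A) = 1"
    using assms(2) by (auto simp: unit_box_def order_box_def)
  have diag: "abs_val (A$1$1) = 1" "abs_val (A$2$2) = 1"
    using unit_box_diagonal[OF assms(1,2)] .
  then have a0: "A$2$2 \<noteq> 0"
    by auto
  have eq: "A = U ** L"
    using a0 by (simp add: L_def U_def matrix2_eq_iff matrix2_mult_nth)
  have detU: "det U = 1"
    by (simp add: U_def det_2)
  have U: "U \<in> unit_box r s'"
    using diag A assms(4) detU by (simp add: unit_box_def order_box_def U_def abs_val_divide)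
  have detL: "abs_val (det L) = 1"
    using A(3) detU unfolding eq det_mul by simp
  then have "abs_val (L$1$1) = 1"
    using diag by (simp add: L_def det_2 abs_val_mult)
  then have "L \<in> unit_box r' s"
    using detL diag A assms(3) by (simp add: unit_box_def order_box_def L_def)
  then show thesis
    using that eq detU U by blast
qed

section \<open>Compact open subgroups and their product decomposition\<close>

lemma closed_subgroup_GL2_inverse:
  assumes "closed_subgroup_GL2 G" "A \<in> G"
  shows "\<exists>B\<in>G. A ** B = mat 1 \<and> B ** A = mat 1"
proof -
  have "invertible A" "matrix_inv A \<in> G"
    using assms by (auto simp: closed_subgroup_GL2_def GL2_def)
  then have "A ** matrix_inv A = mat 1 \<and> matrix_inv A ** A = mat 1"
    unfolding invertible_def matrix_inv_def by (rule_tac someI_ex)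
  then show ?thesis
    using \<open>matrix_inv A \<in> G\<close> by blast
qed

text \<open>Inverses are asked for on the left, as in \<open>operator_group\<close>; for square
  matrices they are automatically two-sided.\<close>

definition compact_open_subgroup ::
    "('k::nonarch_local_field^2^2) set \<Rightarrow> ('k^2^2) set \<Rightarrow> bool" where
  "compact_open_subgroup G K \<longleftrightarrow>
    K \<subseteq> G \<and> mat 1 \<in> K \<and> (\<forall>A\<in>K. \<forall>B\<in>K. A ** B \<in> K) \<and> (\<forall>A\<in>K. \<exists>B\<in>K. B ** A = mat 1) \<and>
    compact K \<and> openin (top_of_set G) K"

lemma unit_box_mult:
  assumes "r * s \<le> 1" "A \<in> unit_box r s" "B \<in> unit_box r s"
  shows "A ** B \<in> unit_box r s"
  using assms order_box_mult by (auto simp: unit_box_def det_mul abs_val_mult)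

lemma one_in_unit_box: "0 \<le> r \<Longrightarrow> 0 \<le> s \<Longrightarrow> mat 1 \<in> unit_box r s"
  by (simp add: unit_box_def order_box_def)

lemma compact_open_unit_box:
  assumes G: "closed_subgroup_GL2 G" and rs: "0 < r" "0 < s" "r * s \<le> 1"
  shows "compact_open_subgroup G (unit_box r s \<inter> G)"
  unfolding compact_open_subgroup_def
proof (intro conjI ballI)
  show "mat 1 \<in> unit_box r s \<inter> G"
    using G rs one_in_unit_box[of r s] by (simp add: closed_subgroup_GL2_def)
next
  fix A B assume "A \<in> unit_box r s \<inter> G" "B \<in> unit_box r s \<inter> G"
  then show "A ** B \<in> unit_box r s \<inter> G"
    using G unit_box_mult[OF rs(3)] by (auto simp: closed_subgroup_GL2_def)
next
  fix A assume A: "A \<in> unit_box r s \<inter> G"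
  obtain B where B: "B \<in> order_box r s" "A ** B = mat 1" "B ** A = mat 1"
    using A order_box_units[OF rs(3)] by (auto simp: unit_box_def)
  have "abs_val (det B) = 1"
    using order_box_units[OF rs(3) B(1)] A B by (auto simp: unit_box_def)
  moreover have "B \<in> G"
  proof -
    obtain C where "C \<in> G" "C ** A = mat 1"
      using closed_subgroup_GL2_inverse[OF G] A by blast
    then show ?thesis
      using B(2) by (metis matrix_mul_assoc matrix_mul_lid matrix_mul_rid)
  qed
  ultimately show "\<exists>B\<in>unit_box r s \<inter> G. B ** A = mat 1"
    using B by (auto simp: unit_box_def)
next
  \<comment> \<open>\<open>G\<close> is closed only relative to \<open>GL2\<close>. Since the box
    lies in \<open>GL2\<close>, intersecting it with \<open>G\<close> is the same as intersecting it
    with the closed set \<open>F\<close>.\<close>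
  obtain F where F: "closed F" "G = GL2 \<inter> F"
    using G by (auto simp: closed_subgroup_GL2_def closedin_closed)
  have "unit_box r s \<subseteq> (GL2 :: ('a^2^2) set)"
    by (auto simp: unit_box_def GL2_def invertible_det_nz)
  then have "unit_box r s \<inter> G = unit_box r s \<inter> F"
    using F by auto
  then show "compact (unit_box r s \<inter> G)"
    by (simp only: compact_Int_closed[OF compact_unit_box F(1)])
next
  show "openin (top_of_set G) (unit_box r s \<inter> G)"
    using open_unit_box[OF rs(1,2)] by (auto simp: openin_open)
qed simp

text \<open>Here the inclusion of \<open>SL2\<close> in \<open>G\<close> enters: the factor of
  determinant 1 lies in \<open>G\<close>, and the other one is then a quotient of elements of
  \<open>G\<close>.\<close>

lemma SL2_left_factor:
  assumes G: "closed_subgroup_GL2 G" and "SL2 \<subseteq> G"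
    and A: "A \<in> G" "A = X ** Y" "det X = 1"
  shows "X \<in> G" "Y \<in> G"
proof -
  show X: "X \<in> G"
    using assms by (auto simp: SL2_def)
  obtain Z where Z: "Z \<in> G" "Z ** X = mat 1"
    using closed_subgroup_GL2_inverse[OF G X] by blast
  then have "Y = Z ** A"
    using A by (simp add: matrix_mul_assoc)
  then show "Y \<in> G"
    using G Z A(1) by (simp add: closed_subgroup_GL2_def)
qed

text \<open>Intersecting segments raises the left end and lowers the right end, so both radii become
  maxima. The alternatives in \<open>cases\<close> stand for the two inclusions and for an
  intersection with at least two elements.\<close>

lemma unit_box_eq_prod:
  assumes G: "closed_subgroup_GL2 G" and SL: "SL2 \<subseteq> G"
    and pos: "0 < r" "0 < s" "0 < r'" "0 < s'" and rs: "r * s \<le> 1" "r' * s' \<le> 1"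
    and cases: "r' \<le> r \<and> s' \<le> s \<or> r \<le> r' \<and> s \<le> s' \<or> max r r' * max s s' < 1"
  shows "unit_box (max r r') (max s s') \<inter> G =
    {A ** B | A B. A \<in> unit_box r s \<inter> G \<and> B \<in> unit_box r' s' \<inter> G}" (is "?M = ?P")
proof (intro equalityI subsetI)
  have max_le: "max r r' * max s s' \<le> 1"
    using cases rs by (auto simp: max_absorb1 max_absorb2)
  fix A assume "A \<in> ?P"
  then obtain X Y where XY: "A = X ** Y" "X \<in> unit_box r s \<inter> G" "Y \<in> unit_box r' s' \<inter> G"
    by blast
  have "X \<in> ?M" "Y \<in> ?M"
    using XY unit_box_mono[of r "max r r'" s "max s s'"] unit_box_mono[of r' "max r r'" s' "max s s'"]
    by auto
  then show "A \<in> ?M"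
    using unit_box_mult[OF max_le] G XY by (auto simp: closed_subgroup_GL2_def)
next
  fix A assume A: "A \<in> ?M"
  have one: "mat 1 \<in> unit_box r s \<inter> G" "mat 1 \<in> unit_box r' s' \<inter> G"
    using G pos by (auto simp: closed_subgroup_GL2_def one_in_unit_box)
  have prodI: "A \<in> ?P" if "A = X ** Y" "det X = 1" "X \<in> unit_box r s" "Y \<in> unit_box r' s'" for X Y
    using SL2_left_factor[OF G SL _ that(1,2)] A that by blast
  \<comment> \<open>In the crossed cases the left factor must lie in \<open>unit_box r s\<close>: it
    is taken lower triangular if that box has the larger \<open>s\<close>, and upper triangular if
    it has the larger \<open>r\<close>.\<close>
  consider "r' \<le> r" "s' \<le> s" | "r \<le> r'" "s \<le> s'"
    | "max r r' * max s s' < 1" "r \<le> r'" "s' \<le> s" | "max r r' * max s s' < 1" "r' \<le> r" "s \<le> s'"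
    using cases by linarith
  then show "A \<in> ?P"
  proof cases
    case 1
    then have "A \<in> unit_box r s \<inter> G"
      using A by (simp add: max_absorb1)
    moreover have "A = A ** mat 1"
      by (simp add: matrix_mul_rid)
    ultimately show ?thesis
      using one by blast
  next
    case 2
    then have "A \<in> unit_box r' s' \<inter> G"
      using A by (simp add: max_absorb2)
    moreover have "A = mat 1 ** A"
      by (simp add: matrix_mul_lid)
    ultimately show ?thesis
      using one by blast
  next
    case 3
    then have "r' * s < 1" "A \<in> unit_box r' s"
      using A by (simp_all add: max_absorb1 max_absorb2)
    then obtain L U where "A = L ** U" "det L = 1" "L \<in> unit_box r s" "U \<in> unit_box r' s'"
      using unit_box_lower_upper[of r' s A r s'] pos by auto
    then show ?thesis
      by (rule prodI)
  next
    case 4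
    then have "r * s' < 1" "A \<in> unit_box r s'"
      using A by (simp_all add: max_absorb1 max_absorb2)
    then obtain U L where "A = U ** L" "det U = 1" "U \<in> unit_box r s" "L \<in> unit_box r' s'"
      using unit_box_upper_lower[of r s' A r' s] pos by auto
    then show ?thesis
      by (rule prodI)
  qed
qed

section \<open>Haar measure of cosets and the averaging operator\<close>

lemma compact_subset_openin_cover:
  assumes "compact C" "C \<subseteq> G" "\<And>i. i \<in> I \<Longrightarrow> openin (top_of_set G) (U i)" "C \<subseteq> (\<Union>i\<in>I. U i)"
  obtains J where "J \<subseteq> I" "finite J" "C \<subseteq> (\<Union>i\<in>J. U i)"
proof -
  \<comment> \<open>Relatively open sets are lifted to open sets of the ambient space, where
    compactness of \<open>C\<close> applies.\<close>
  obtain T where T: "\<And>i. i \<in> I \<Longrightarrow> open (T i) \<and> U i = G \<inter> T i"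
    using assms(3) unfolding openin_open by metis
  have "C \<subseteq> (\<Union>i\<in>I. T i)"
    using assms(4) T by blast
  then obtain J where J: "J \<subseteq> I" "finite J" "C \<subseteq> (\<Union>i\<in>J. T i)"
    using compactE_image[OF assms(1), of I T] T by blast
  have "C \<subseteq> (\<Union>i\<in>J. U i)"
  proof
    fix x assume "x \<in> C"
    then obtain i where "i \<in> J" "x \<in> T i"
      using J by blast
    then show "x \<in> (\<Union>i\<in>J. U i)"
      using T[of i] J \<open>x \<in> C\<close> assms(2) by blast
  qed
  then show thesis
    using that J by blast
qed

locale haar_representation =
  fixes G :: "('k::nonarch_local_field^2^2) set"
    and \<mu> :: "('k^2^2) measure"
    and smul :: "complex \<Rightarrow> 'v::ab_group_add \<Rightarrow> 'v"
    and \<pi> :: "'k^2^2 \<Rightarrow> 'v \<Rightarrow> 'v"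
  assumes subgroup: "closed_subgroup_GL2 G"
    and haar: "haar_measure G \<mu>"
    and rep: "smooth_representation G smul \<pi>"
begin

sublocale vector_space smul
  using rep by (simp add: smooth_representation_def)

lemma G_mult: "g \<in> G \<Longrightarrow> h \<in> G \<Longrightarrow> g ** h \<in> G"
  using subgroup by (simp add: closed_subgroup_GL2_def)

lemma rep_mult: "g \<in> G \<Longrightarrow> h \<in> G \<Longrightarrow> \<pi> (g ** h) v = \<pi> g (\<pi> h v)"
  using rep by (simp add: smooth_representation_def)

lemma rep_one: "\<pi> (mat 1) = id"
  using rep by (simp add: smooth_representation_def)

lemma space_haar: "space \<mu> = G"
  using haar sets_eq_imp_space_eq[of \<mu> "restrict_space borel G"]
  by (simp add: haar_measure_def space_restrict_space)

lemma openin_sets: "openin (top_of_set G) U \<Longrightarrow> U \<in> sets \<mu>"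
  using haar by (auto simp: haar_measure_def openin_open sets_restrict_space)

lemma emeasure_translate: "g \<in> G \<Longrightarrow> A \<in> sets \<mu> \<Longrightarrow> emeasure \<mu> ((**) g ` A) = emeasure \<mu> A"
  using haar by (simp add: haar_measure_def)

text \<open>A left translate by \<open>g\<close> is the preimage under the continuous translation by
  the inverse \<open>h\<close>.\<close>

lemma openin_translate:
  assumes g: "g \<in> G" and U: "openin (top_of_set G) U"
  shows "openin (top_of_set G) ((**) g ` U)"
proof -
  obtain h where h: "h \<in> G" "g ** h = mat 1" "h ** g = mat 1"
    using closed_subgroup_GL2_inverse[OF subgroup g] by blast
  have UG: "U \<subseteq> G"
    using U openin_imp_subset by blast
  have "(**) g ` U = G \<inter> (**) h -` U"
  proof (intro equalityI subsetI)
    fix x assume "x \<in> G \<inter> (**) h -` U"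
    then show "x \<in> (**) g ` U"
      using h by (intro image_eqI[of _ _ "h ** x"]) (auto simp: matrix_mul_assoc matrix_mul_lid)
  next
    fix x assume "x \<in> (**) g ` U"
    then show "x \<in> G \<inter> (**) h -` U"
      using h g UG by (auto simp: matrix_mul_assoc matrix_mul_lid intro: G_mult)
  qed
  moreover have "openin (top_of_set G) (G \<inter> (**) h -` U)"
    using h U G_mult
    by (intro continuous_openin_preimage[of _ _ G]
        continuous_on_matrix_mult2 continuous_on_const continuous_on_id) auto
  ultimately show ?thesis
    by simp
qed

text \<open>
  An open set of measure zero containing the identity would make every compact subset of \<open>G\<close> a
  null set, since finitely many translates cover it.
\<close>

lemma emeasure_open_pos:
  assumes "openin (top_of_set G) K" "mat 1 \<in> K"
  shows "emeasure \<mu> K \<noteq> 0"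
proof
  assume zero: "emeasure \<mu> K = 0"
  have "emeasure \<mu> C = 0" if C: "compact C" "C \<subseteq> G" for C
  proof -
    have op: "openin (top_of_set G) ((**) g ` K)" if "g \<in> C" for g
      using that C assms by (auto intro: openin_translate)
    have "C \<subseteq> (\<Union>g\<in>C. (**) g ` K)"
      using assms(2) by (force simp: matrix_mul_rid)
    then obtain J where J: "J \<subseteq> C" "finite J" "C \<subseteq> (\<Union>g\<in>J. (**) g ` K)"
      using compact_subset_openin_cover[OF C op, of C "\<lambda>g. g"] by blast
    have sets: "(\<lambda>g. (**) g ` K) ` J \<subseteq> sets \<mu>"
      using op J openin_sets by blast
    have "emeasure \<mu> C \<le> emeasure \<mu> (\<Union>g\<in>J. (**) g ` K)"
      using J sets by (intro emeasure_mono sets.finite_UN) auto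
    also have "\<dots> \<le> (\<Sum>g\<in>J. emeasure \<mu> ((**) g ` K))"
      by (rule emeasure_subadditive_finite[OF J(2) sets])
    also have "\<dots> = (\<Sum>g\<in>J. 0)"
      using J C zero assms openin_sets by (intro sum.cong) (auto simp: emeasure_translate)
    finally show ?thesis
      by simp
  qed
  \<comment> \<open>Inner regularity on the open set \<open>G\<close> turns null compact subsets
    into a null group.\<close>
  moreover have "emeasure \<mu> G = (SUP C\<in>{C. compact C \<and> C \<subseteq> G}. emeasure \<mu> C)"
    using haar unfolding haar_measure_def by auto
  ultimately have "emeasure \<mu> G \<le> 0"
    by (simp only:) (rule SUP_least, simp)
  then show False
    using haar by (simp add: haar_measure_def)
qed

context
  fixes K
  assumes K: "compact_open_subgroup G K"
begin

lemma compact_open_subgroupD: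
  "K \<subseteq> G" "mat 1 \<in> K" "compact K" "openin (top_of_set G) K"
  "g \<in> K \<Longrightarrow> h \<in> K \<Longrightarrow> g ** h \<in> K" "g \<in> K \<Longrightarrow> \<exists>h\<in>K. h ** g = mat 1"
  using K by (auto simp: compact_open_subgroup_def)

lemma operator_group_rep: "operator_group smul (\<pi> ` K)"
proof (intro operator_group.intro operator_group_axioms.intro vector_space_axioms)
  fix f assume "f \<in> \<pi> ` K"
  then show "Vector_Spaces.linear smul smul f"
    using rep compact_open_subgroupD(1) by (auto simp: smooth_representation_def)
next
  show "id \<in> \<pi> ` K"
    using rep_one compact_open_subgroupD(2) by (metis image_eqI)
next
  fix f g assume "f \<in> \<pi> ` K" "g \<in> \<pi> ` K"
  then obtain x y where xy: "x \<in> K" "y \<in> K" "f = \<pi> x" "g = \<pi> y"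
    by blast
  have "f \<circ> g = \<pi> (x ** y)"
    using xy compact_open_subgroupD(1) by (intro ext) (simp add: rep_mult subset_iff)
  then show "f \<circ> g \<in> \<pi> ` K"
    using xy compact_open_subgroupD(5) by blast
next
  fix f assume "f \<in> \<pi> ` K"
  then obtain x where x: "x \<in> K" "f = \<pi> x"
    by blast
  obtain y where y: "y \<in> K" "y ** x = mat 1"
    using compact_open_subgroupD(6) x by blast
  have "\<pi> y \<circ> f = \<pi> (y ** x)"
    using x y(1) compact_open_subgroupD(1) by (intro ext) (simp add: rep_mult subset_iff)
  then show "\<exists>g\<in>\<pi> ` K. g \<circ> f = id"
    using y rep_one by auto
qed

text \<open>Level sets of the orbit map are left cosets of the stabilizer of \<open>v\<close>; this
  makes them open and of equal measure.\<close>

lemma coset_eq: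
  assumes g: "g \<in> K"
  shows "{h \<in> K. \<pi> h v = \<pi> g v} = (**) g ` {h \<in> K. \<pi> h v = v}"
proof (intro equalityI subsetI)
  fix x assume "x \<in> (**) g ` {h \<in> K. \<pi> h v = v}"
  then obtain h where "h \<in> K" "\<pi> h v = v" "x = g ** h"
    by blast
  then show "x \<in> {h \<in> K. \<pi> h v = \<pi> g v}"
    using g compact_open_subgroupD(1,5) by (auto simp: rep_mult subset_iff)
next
  fix x assume x: "x \<in> {h \<in> K. \<pi> h v = \<pi> g v}"
  obtain h where h: "h \<in> K" "h ** g = mat 1"
    using compact_open_subgroupD(6) g by blast
  then have "g ** h = mat 1"
    using matrix_left_right_inverse by blast
  then have "x = g ** (h ** x)"
    by (simp add: matrix_mul_assoc matrix_mul_lid)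
  moreover have "\<pi> (h ** x) v = v"
  proof -
    have "\<pi> (h ** x) v = \<pi> h (\<pi> g v)"
      using h x compact_open_subgroupD(1) by (auto simp: rep_mult subset_iff)
    also have "\<dots> = \<pi> (h ** g) v"
      using h(1) g compact_open_subgroupD(1) by (simp add: rep_mult subset_iff)
    finally show ?thesis
      using h rep_one by simp
  qed
  ultimately show "x \<in> (**) g ` {h \<in> K. \<pi> h v = v}"
    using h x compact_open_subgroupD(5) by blast
qed

lemma openin_stabilizer: "openin (top_of_set G) {h \<in> K. \<pi> h v = v}"
proof -
  have "openin (top_of_set G) (K \<inter> {h \<in> G. \<pi> h v = v})"
    using compact_open_subgroupD(4) rep by (auto simp: smooth_representation_def)
  moreover have "K \<inter> {h \<in> G. \<pi> h v = v} = {h \<in> K. \<pi> h v = v}"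
    using compact_open_subgroupD(1) by auto
  ultimately show ?thesis
    by simp
qed

lemma orbit_of_rep: "orbit_of (\<pi> ` K) v = (\<lambda>g. \<pi> g v) ` K"
  by (simp add: orbit_of_def image_image)

lemma openin_coset:
  assumes "g \<in> K"
  shows "openin (top_of_set G) {h \<in> K. \<pi> h v = \<pi> g v}"
  unfolding coset_eq[OF assms]
  using assms compact_open_subgroupD(1) openin_stabilizer by (auto intro: openin_translate)

text \<open>The open level sets of the orbit map cover the compact \<open>K\<close>; a finite
  subcover supplies representatives of all orbit elements.\<close>

lemma finite_orbit: "finite (orbit_of (\<pi> ` K) v)"
proof -
  have "K \<subseteq> (\<Union>g\<in>K. {h \<in> K. \<pi> h v = \<pi> g v})"
    by auto
  from compact_subset_openin_cover[OF compact_open_subgroupD(3,1) openin_coset this]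
  obtain J where J: "J \<subseteq> K" "finite J" "K \<subseteq> (\<Union>g\<in>J. {h \<in> K. \<pi> h v = \<pi> g v})" .
  then have "(\<lambda>g. \<pi> g v) ` K \<subseteq> (\<lambda>g. \<pi> g v) ` J"
    by fastforce
  then show ?thesis
    unfolding orbit_of_rep using J finite_surj by blast
qed

lemma measure_subgroup_pos: "measure \<mu> K > 0"
proof -
  \<comment> \<open>Finiteness matters for positivity too, because \<open>measure\<close> is 0 on
    sets of infinite \<open>emeasure\<close>.\<close>
  have "emeasure \<mu> K < \<infinity>"
    using haar compact_open_subgroupD(1,3) by (simp add: haar_measure_def)
  moreover have "emeasure \<mu> K \<noteq> 0"
    using emeasure_open_pos compact_open_subgroupD by blast
  ultimately show ?thesis
    by (simp add: measure_def enn2real_positive_iff zero_less_iff_neq_zero)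
qed

text \<open>The orbit-stabilizer theorem in measure form: \<open>K\<close> is the disjoint union of
  the level sets, which are translates of one another.\<close>

lemma measure_coset:
  assumes w: "w \<in> orbit_of (\<pi> ` K) v"
  shows "measure \<mu> {h \<in> K. \<pi> h v = w} = measure \<mu> K / card (orbit_of (\<pi> ` K) v)"
proof -
  let ?O = "orbit_of (\<pi> ` K) v" and ?F = "\<lambda>w. {h \<in> K. \<pi> h v = w}"
  let ?e = "emeasure \<mu> {h \<in> K. \<pi> h v = v}"
  have e: "emeasure \<mu> (?F u) = ?e" and sets: "?F u \<in> sets \<mu>" if u: "u \<in> ?O" for u
  proof -
    obtain g where g: "g \<in> K" "u = \<pi> g v"
      using u by (auto simp: orbit_of_rep)
    show "?F u \<in> sets \<mu>"
      using g openin_coset openin_sets by blast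
    show "emeasure \<mu> (?F u) = ?e"
      unfolding g(2) coset_eq[OF g(1)]
      using g(1) compact_open_subgroupD(1) openin_stabilizer
      by (auto intro!: emeasure_translate openin_sets)
  qed
  have "emeasure \<mu> (\<Union>u\<in>?O. ?F u) = (\<Sum>u\<in>?O. emeasure \<mu> (?F u))"
    using sets finite_orbit
    by (intro sum_emeasure[symmetric]) (auto simp: disjoint_family_on_def)
  also have "\<dots> = of_nat (card ?O) * ?e"
    using e by simp
  also have "(\<Union>u\<in>?O. ?F u) = K"
    by (auto simp: orbit_of_rep)
  finally have "measure \<mu> K = card ?O * measure \<mu> (?F w)"
    using e[OF w] by (simp add: measure_def enn2real_mult)
  moreover have "card ?O \<noteq> 0"
    using w finite_orbit by auto
  ultimately show ?thesis
    by simp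
qed

text \<open>A nonzero orbit element \<open>w\<close> contributes its coset volume, the volume of
  \<open>K\<close> divided by the orbit size; the normalizing factor cancels the volume of
  \<open>K\<close>.\<close>

lemma rep_op_eq_orbit_avg:
  "rep_op smul \<mu> \<pi> (\<lambda>g. inverse (complex_of_real (measure \<mu> K)) * indicator K g) v =
    orbit_avg smul (\<pi> ` K) v"
proof -
  define c where "c = complex_of_real (measure \<mu> K)"
  define F where "F g = smul (inverse c * indicator K g) (\<pi> g v)" for g
  let ?O = "orbit_of (\<pi> ` K) v"
  let ?n = "of_nat (card ?O) :: complex"
  have c: "c \<noteq> 0"
    using measure_subgroup_pos by (simp add: c_def)
  have F_in: "F g = smul (inverse c) (\<pi> g v)" if "g \<in> K" for g
    using that by (simp add: F_def)
  have F_out: "F g = 0" if "g \<notin> K" for g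
    using that by (simp add: F_def)
  have inj: "inj_on (smul (inverse c)) X" for X
    using c by (auto simp: inj_on_def)
  \<comment> \<open>The value 0 is set apart because \<open>F\<close> also vanishes on all of
    \<open>G\<close> outside \<open>K\<close>.\<close>
  have meas: "measure \<mu> {g \<in> G. F g = smul (inverse c) w} = measure \<mu> K / card ?O"
    if "w \<in> ?O" "w \<noteq> 0" for w
  proof -
    have "{g \<in> G. F g = smul (inverse c) w} = {h \<in> K. \<pi> h v = w}"
    proof (intro equalityI subsetI)
      fix g assume g: "g \<in> {g \<in> G. F g = smul (inverse c) w}"
      then have "g \<in> K"
        using F_out[of g] that(2) c by (cases "g \<in> K") auto
      then show "g \<in> {h \<in> K. \<pi> h v = w}"
        using g c by (simp add: F_in)
    qed (use compact_open_subgroupD(1) F_in in auto)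
    then show ?thesis
      using measure_coset[OF that(1)] by simp
  qed
  have ran: "F ` G - {0} = smul (inverse c) ` (?O - {0})"
  proof (intro equalityI subsetI)
    fix x assume "x \<in> F ` G - {0}"
    then obtain g where g: "x = F g" "F g \<noteq> 0"
      by blast
    then have "g \<in> K"
      using F_out by blast
    then show "x \<in> smul (inverse c) ` (?O - {0})"
      using g by (auto simp: F_in orbit_of_rep)
  next
    fix x assume "x \<in> smul (inverse c) ` (?O - {0})"
    then obtain g where g: "g \<in> K" "\<pi> g v \<noteq> 0" "x = smul (inverse c) (\<pi> g v)"
      by (auto simp: orbit_of_rep)
    then have "x = F g" "x \<noteq> 0"
      using c by (simp_all add: F_in)
    then show "x \<in> F ` G - {0}"
      using g(1) compact_open_subgroupD(1) by blast
  qed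
  have "rep_op smul \<mu> \<pi> (\<lambda>g. inverse c * indicator K g) v =
      (\<Sum>x\<in>F ` G - {0}. smul (complex_of_real (measure \<mu> {g \<in> G. F g = x})) x)"
    unfolding rep_op_def vec_integral_def F_def space_haar ..
  also have "\<dots> = (\<Sum>w\<in>?O - {0}. smul (complex_of_real (measure \<mu> {g \<in> G. F g = smul (inverse c) w}))
      (smul (inverse c) w))"
    unfolding ran sum.reindex[OF inj] by simp
  also have "\<dots> = (\<Sum>w\<in>?O - {0}. smul (1 / ?n) w)"
  proof (intro sum.cong refl)
    fix w assume "w \<in> ?O - {0}"
    then have "measure \<mu> {g \<in> G. F g = smul (inverse c) w} = measure \<mu> K / card ?O"
      by (intro meas) auto
    then have "complex_of_real (measure \<mu> {g \<in> G. F g = smul (inverse c) w}) = c / ?n"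
      by (simp only: c_def of_real_divide of_real_of_nat_eq)
    then show "smul (complex_of_real (measure \<mu> {g \<in> G. F g = smul (inverse c) w}))
        (smul (inverse c) w) = smul (1 / ?n) w"
      using c by simp
  qed
  also have "\<dots> = (\<Sum>w\<in>?O. smul (1 / ?n) w)"
    using finite_orbit by (intro sum.mono_neutral_left) auto
  finally show ?thesis
    by (simp add: orbit_avg_def scale_sum_right c_def)
qed

end

text \<open>Since \<open>\<pi>\<close> is multiplicative on \<open>G\<close>, the factorization of
  \<open>M\<close> passes to the sets of operators.\<close>

lemma orbit_avg_rep_comp:
  assumes K: "compact_open_subgroup G K" and H: "compact_open_subgroup G H"
    and M: "compact_open_subgroup G M" and prod: "M = {A ** B | A B. A \<in> K \<and> B \<in> H}"
  shows "orbit_avg smul (\<pi> ` K) (orbit_avg smul (\<pi> ` H) v) = orbit_avg smul (\<pi> ` M) v"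
proof (rule orbit_avg_orbit_avg)
  have KG: "K \<subseteq> G" and HG: "H \<subseteq> G"
    using K H by (auto simp: compact_open_subgroup_def)
  have eq: "\<pi> (A ** B) = \<pi> A \<circ> \<pi> B" if "A \<in> K" "B \<in> H" for A B
    using that KG HG by (intro ext) (simp add: rep_mult subset_iff)
  show "\<pi> ` M = {f \<circ> g | f g. f \<in> \<pi> ` K \<and> g \<in> \<pi> ` H}"
  proof (intro equalityI subsetI)
    fix x assume "x \<in> \<pi> ` M"
    then show "x \<in> {f \<circ> g | f g. f \<in> \<pi> ` K \<and> g \<in> \<pi> ` H}"
      using eq by (auto simp: prod)
  next
    fix x assume "x \<in> {f \<circ> g | f g. f \<in> \<pi> ` K \<and> g \<in> \<pi> ` H}"
    then obtain A B where "A \<in> K" "B \<in> H" "x = \<pi> (A ** B)"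
      using eq by auto
    then show "x \<in> \<pi> ` M"
      by (auto simp: prod)
  qed
qed (use assms operator_group_rep finite_orbit in auto)

end

section \<open>Composition of the idempotents of two segments\<close>

theorem lemma6:
  fixes G :: "('k::nonarch_local_field^2^2) set"
    and \<mu> :: "('k^2^2) measure"
    and smul :: "complex \<Rightarrow> 'v::ab_group_add \<Rightarrow> 'v"
    and \<pi> :: "'k^2^2 \<Rightarrow> 'v \<Rightarrow> 'v"
    and l l' :: "int set"
  assumes "closed_subgroup_GL2 G"
    and "SL2 \<subseteq> G"
    and "haar_measure G \<mu>"
    and "smooth_representation G smul \<pi>"
    and "segment l" and "segment l'"
    and "l \<subseteq> l' \<or> l' \<subseteq> l \<or> card (l \<inter> l') \<ge> 2"
  shows "seg_idem G \<mu> smul \<pi> l \<circ> seg_idem G \<mu> smul \<pi> l' = seg_idem G \<mu> smul \<pi> (l \<inter> l')"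
proof -
  interpret haar_representation G \<mu> smul \<pi>
    using assms by unfold_locales
  obtain m n m' n' where l: "m \<le> n" "l = {m..n}" and l': "m' \<le> n'" "l' = {m'..n'}"
    using assms(5,6) by (auto simp: segment_def)
  have int: "l \<inter> l' = {max m m'..min n n'}"
    by (simp add: l l')
  \<comment> \<open>Each of the three alternatives makes the intersection nonempty, hence again a
    segment.\<close>
  have pos: "max m m' \<le> min n n'"
    using assms(7) l l' unfolding int by (auto simp: max_def min_def split: if_splits)
  obtain q where q: "0 < q" "q < 1" "\<And>i. max_ideal_pow i = {x :: 'k. abs_val x \<le> q powi i}"
    using ex_max_ideal_pow_eq by blast
  have mono: "q powi i \<le> q powi j" if "j \<le> i" for i j
    using q that by (simp add: power_int_decreasing)
  have prod_le: "q powi (- i) * q powi j \<le> 1" if "i \<le> j" for i j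
    using q(1) mono[of 0 "j - i"] that by (simp add: power_int_add[symmetric])
  have prod_less: "q powi (- i) * q powi j < 1" if "i < j" for i j
    using q power_int_strict_decreasing[of 0 "j - i" q] that by (simp add: power_int_add[symmetric])
  \<comment> \<open>As \<open>q < 1\<close>, powers of \<open>q\<close> reverse the order of
    exponents, so the smaller exponent gives the larger radius.\<close>
  have max_m: "q powi (- max m m') = max (q powi (- m)) (q powi (- m'))"
    using mono[of "- m" "- m'"] mono[of "- m'" "- m"] by (auto simp: max_def)
  have max_n: "q powi min n n' = max (q powi n) (q powi n')"
    using mono[of n n'] mono[of n' n] by (auto simp: max_def min_def)
  have cases: "q powi (- m') \<le> q powi (- m) \<and> q powi n' \<le> q powi n \<or>
      q powi (- m) \<le> q powi (- m') \<and> q powi n \<le> q powi n' \<or>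
      max (q powi (- m)) (q powi (- m')) * max (q powi n) (q powi n') < 1"
    using assms(7)
  proof (elim disjE)
    assume "l \<subseteq> l'"
    then show ?thesis
      using l l' mono by simp
  next
    assume "l' \<subseteq> l"
    then show ?thesis
      using l l' mono by simp
  next
    assume "2 \<le> card (l \<inter> l')"
    \<comment> \<open>Two elements mean distinct endpoints, which gives the strict bound on the
      product of the radii and with it unit diagonal entries.\<close>
    then have "max m m' < min n n'"
      unfolding int card_atLeastAtMost_int by linarith
    then show ?thesis
      using prod_less[of "max m m'" "min n n'"] unfolding max_m max_n by blast
  qed
  have K: "compact_open_subgroup G (seg_subgroup G {i..j})" if "i \<le> j" for i j
    using that q(1) prod_le by (simp add: seg_subgroup_eq[OF q] compact_open_unit_box[OF assms(1)])
  have idem: "seg_idem G \<mu> smul \<pi> {i..j} v = orbit_avg smul (\<pi> ` seg_subgroup G {i..j}) v"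
    if "i \<le> j" for i j v
    unfolding seg_idem_def by (rule rep_op_eq_orbit_avg[OF K[OF that]])
  have prod: "seg_subgroup G {max m m'..min n n'} =
      {A ** B | A B. A \<in> seg_subgroup G {m..n} \<and> B \<in> seg_subgroup G {m'..n'}}"
    unfolding seg_subgroup_eq[OF q pos] seg_subgroup_eq[OF q l(1)] seg_subgroup_eq[OF q l'(1)]
      max_m max_n
    using q(1) prod_le l l' cases by (intro unit_box_eq_prod assms) simp_all
  show ?thesis
    unfolding int unfolding l(2) l'(2)
    using orbit_avg_rep_comp[OF K[OF l(1)] K[OF l'(1)] K[OF pos] prod]
    by (simp add: idem[OF l(1)] idem[OF l'(1)] idem[OF pos] fun_eq_iff)
qed

end
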